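(* Let $G$ be a graph. For every pair of edges $xy, uv\in E(G)$, we have $S_{xy}=S_{uv}$ if and only if $xy\in S_{uv}$.
   Context: For $e\in E(G)$, let $\mathcal{S}_e$ be the family of all sets $S\subseteq E(G)$ such that $e\in S$ and, for every edge $d\notin S$, there is no induced copy of $P_3$ in $G$ consisting of $d$ and an edge of $S$. $S_e$ denotes the member of $\mathcal{S}_e$ of minimum cardinality (it is unique; equivalently it is the intersection of all members of $\mathcal{S}_e$). *)

theory Defs
  imports Main
begin

text \<open>A graph is finite, simple and undirected; edges are two-element sets of vertices.\<close>

definition fin_simple_graph :: "'a set \<Rightarrow> 'a set set \<Rightarrow> bool" where
  "fin_simple_graph V E \<longleftrightarrow> finite V \<and> (\<forall>e\<in>E. e \<subseteq> V \<and> card e = 2)"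

definition induced_edges :: "'a set set \<Rightarrow> 'a set \<Rightarrow> 'a set set" where
  "induced_edges E W = {e \<in> E. e \<subseteq> W}"

text \<open>\<open>P\<^sub>3\<close> is the path on three vertices, hence with two edges.\<close>

definition is_P3 :: "'a set \<Rightarrow> 'a set set \<Rightarrow> bool" where
  "is_P3 W F \<longleftrightarrow> (\<exists>a b c. a \<noteq> b \<and> b \<noteq> c \<and> a \<noteq> c \<and> W = {a, b, c} \<and> F = {{a, b}, {b, c}})"

definition induced_P3 :: "'a set \<Rightarrow> 'a set set \<Rightarrow> 'a set \<Rightarrow> 'a set \<Rightarrow> bool" where
  "induced_P3 V E d f \<longleftrightarrow>
     (\<exists>W\<subseteq>V. is_P3 W (induced_edges E W) \<and> induced_edges E W = {d, f})"

definition S_family :: "'a set \<Rightarrow> 'a set set \<Rightarrow> 'a set \<Rightarrow> 'a set set set" where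
  "S_family V E e = {S. S \<subseteq> E \<and> e \<in> S \<and> (\<forall>d \<in> E - S. \<not> (\<exists>f\<in>S. induced_P3 V E d f))}"

definition S_edge :: "'a set \<Rightarrow> 'a set set \<Rightarrow> 'a set \<Rightarrow> 'a set set" where
  "S_edge V E e = (THE S. S \<in> S_family V E e \<and> (\<forall>T \<in> S_family V E e. card S \<le> card T))"

end

theory Submission
  imports Defs
begin

text \<open>
  The families are closed under intersection, so \<open>S\<^sub>e\<close> is the least member of its family. If
  \<open>f \<in> S\<^sub>e\<close>, then \<open>S\<^sub>f \<subseteq> S\<^sub>e\<close>. Forming an induced \<open>P\<^sub>3\<close> is a symmetric relation, so removing one
  closed set from another leaves a closed set; were \<open>e \<notin> S\<^sub>f\<close>, then \<open>S\<^sub>e - S\<^sub>f\<close> would be a member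
  of the family of \<open>e\<close> that misses \<open>f \<in> S\<^sub>e\<close>. So \<open>e \<in> S\<^sub>f\<close> and \<open>S\<^sub>e \<subseteq> S\<^sub>f\<close>.
\<close>

lemma induced_P3_commute: "induced_P3 V E d f \<longleftrightarrow> induced_P3 V E f d"
  by (simp add: induced_P3_def insert_commute)

lemma fin_simple_graph_finite_edges:
  assumes "fin_simple_graph V E"
  shows "finite E"
  using assms finite_subset[of E "Pow V"] by (auto simp: fin_simple_graph_def)

text \<open>An edge outside the intersection is missing from some member \<open>T\<close>, and every
  edge of the intersection lies in \<open>T\<close>, so closedness of \<open>T\<close>
  applies.\<close>

lemma Inter_S_family_in_S_family:
  assumes "e \<in> E"
  shows "\<Inter>(S_family V E e) \<in> S_family V E e"
proof -
  have "E \<in> S_family V E e"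
    using assms by (auto simp: S_family_def)
  then show ?thesis
    unfolding S_family_def by blast
qed

lemma S_edge_eq_Inter:
  assumes "finite E" and "e \<in> E"
  shows "S_edge V E e = \<Inter>(S_family V E e)"
  unfolding S_edge_def
proof (rule the_equality)
  let ?M = "\<Inter>(S_family V E e)"
  have M: "?M \<in> S_family V E e"
    using assms(2) by (rule Inter_S_family_in_S_family)
  have fin: "finite T" if "T \<in> S_family V E e" for T
    using that assms(1) by (auto simp: S_family_def intro: finite_subset)
  show "?M \<in> S_family V E e \<and> (\<forall>T\<in>S_family V E e. card ?M \<le> card T)"
    using M fin by (auto intro!: card_mono)
  show "T = ?M" if "T \<in> S_family V E e \<and> (\<forall>T'\<in>S_family V E e. card T \<le> card T')" for T
    \<comment> \<open>\<open>?M\<close> is contained in \<open>T\<close> and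
      \<open>card T \<le> card ?M\<close>, so finiteness of \<open>T\<close> forces
      equality.\<close>
    using that M fin by (metis Inter_lower card_seteq)
qed

lemma S_family_Diff:
  assumes "S \<in> S_family V E e" and "T \<in> S_family V E f" and "e \<notin> T"
  shows "S - T \<in> S_family V E e"
proof -
  have "\<not> induced_P3 V E d g" if "d \<in> E - (S - T)" and "g \<in> S - T" for d g
  proof (cases "d \<in> S")
    case True
    \<comment> \<open>Here \<open>d\<close> lies in \<open>T\<close> and \<open>g\<close> does not,
      so closedness of \<open>T\<close> applies with \<open>g\<close> as the outer edge.\<close>
    then have "\<not> induced_P3 V E g d"
      using that assms(1,2) by (auto simp: S_family_def)
    then show ?thesis
      by (simp add: induced_P3_commute)
  next
    case False
    then show ?thesis
      using that assms(1) by (auto simp: S_family_def)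
  qed
  then show ?thesis
    using assms(1,3) by (auto simp: S_family_def)
qed

lemma S_edge_in_S_family:
  assumes "finite E" and "e \<in> E"
  shows "S_edge V E e \<in> S_family V E e"
  using assms by (simp add: S_edge_eq_Inter Inter_S_family_in_S_family)

lemma S_edge_least:
  assumes "finite E" and "T \<in> S_family V E e"
  shows "S_edge V E e \<subseteq> T"
proof -
  have "e \<in> E"
    using assms(2) by (auto simp: S_family_def)
  then show ?thesis
    using assms by (simp add: S_edge_eq_Inter Inter_lower)
qed

lemma mem_S_edge_self:
  assumes "finite E" and "e \<in> E"
  shows "e \<in> S_edge V E e"
  using S_edge_in_S_family[OF assms] by (auto simp: S_family_def)

text \<open>The closedness condition does not mention \<open>e\<close>, so a closed set belongs to
  the family of each of its edges.\<close>

lemma S_edge_subset: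
  assumes "finite E" and "e \<in> E" and "f \<in> S_edge V E e"
  shows "S_edge V E f \<subseteq> S_edge V E e"
proof (rule S_edge_least)
  show "S_edge V E e \<in> S_family V E f"
    using S_edge_in_S_family[OF assms(1,2)] assms(3) by (auto simp: S_family_def)
qed (fact assms(1))

lemma mem_S_edge_sym:
  assumes "finite E" and "e \<in> E" and "f \<in> E" and "f \<in> S_edge V E e"
  shows "e \<in> S_edge V E f"
proof (rule ccontr)
  assume "e \<notin> S_edge V E f"
  then have "S_edge V E e - S_edge V E f \<in> S_family V E e"
    using S_family_Diff S_edge_in_S_family assms(1-3) by metis
  then have "S_edge V E e \<subseteq> S_edge V E e - S_edge V E f"
    by (rule S_edge_least[OF assms(1)])
  \<comment> \<open>The edge \<open>f\<close> lies in both \<open>S_edge V E e\<close> and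
    \<open>S_edge V E f\<close>.\<close>
  then show False
    using assms mem_S_edge_self by fast
qed

theorem theorem6:
  fixes V :: "'a set" and E :: "'a set set" and x y u v :: 'a
  assumes "fin_simple_graph V E"
    and "{x, y} \<in> E" and "{u, v} \<in> E"
  shows "S_edge V E {x, y} = S_edge V E {u, v} \<longleftrightarrow> {x, y} \<in> S_edge V E {u, v}"
proof
  have fin: "finite E"
    using assms(1) by (rule fin_simple_graph_finite_edges)
  show "{x, y} \<in> S_edge V E {u, v}" if "S_edge V E {x, y} = S_edge V E {u, v}"
    using mem_S_edge_self[OF fin assms(2)] that by metis
  show "S_edge V E {x, y} = S_edge V E {u, v}" if "{x, y} \<in> S_edge V E {u, v}"
  proof
    show "S_edge V E {x, y} \<subseteq> S_edge V E {u, v}"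
      using fin assms(3) that by (rule S_edge_subset)
    have "{u, v} \<in> S_edge V E {x, y}"
      using fin assms(3,2) that by (rule mem_S_edge_sym)
    with fin assms(2) show "S_edge V E {u, v} \<subseteq> S_edge V E {x, y}"
      by (rule S_edge_subset)
  qed
qed

end
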